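(* Let $G$ be a finite simple undirected graph that is AT-free, and let $\chi(G)$ be its chromatic number. Then $\mathrm{box}(G) \le \chi(G)$.
   Context: An asteroidal triple in $G$ is an independent set of three vertices such that between each pair of them there is a path avoiding the (open) neighbourhood of the third; $G$ is AT-free if it has no asteroidal triple. The boxicity $\mathrm{box}(G)$ is the minimum integer $k$ such that $G$ is the intersection graph of a family of axis-parallel $k$-dimensional boxes (Cartesian products $R_1\times\cdots\times R_k$ of closed real intervals), equivalently the minimum $k$ such that $G = I_1\cap\cdots\cap I_k$ for interval graphs $I_j$ on vertex set $V(G)$ (intersection meaning same vertex set and intersection of edge sets). *)

theory Defs
  imports Complex_Main "HOL-Library.FuncSet" "Graph_Theory.Digraph" "Graph_Theory.Vertex_Walk"
begin

text \<open>
  Finite simple undirected graphs are the library's \<^locale>\<open>graph\<close>: finite, loop-free,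
  symmetric digraphs without parallel arcs (the null graph is allowed).
\<close>

definition neighbourhood :: "('a,'b) pre_digraph \<Rightarrow> 'a \<Rightarrow> 'a set" where
  "neighbourhood G v = {u \<in> verts G. v \<rightarrow>\<^bsub>G\<^esub> u}"

definition independent_set :: "('a,'b) pre_digraph \<Rightarrow> 'a set \<Rightarrow> bool" where
  "independent_set G S \<longleftrightarrow> S \<subseteq> verts G \<and> (\<forall>u\<in>S. \<forall>v\<in>S. \<not> u \<rightarrow>\<^bsub>G\<^esub> v)"

definition path_avoiding :: "('a,'b) pre_digraph \<Rightarrow> 'a \<Rightarrow> 'a \<Rightarrow> 'a set \<Rightarrow> bool" where
  "path_avoiding G x y S \<longleftrightarrow>
     (\<exists>p. vpath p G \<and> hd p = x \<and> last p = y \<and> set p \<inter> S = {})"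

definition asteroidal_triple :: "('a,'b) pre_digraph \<Rightarrow> 'a \<Rightarrow> 'a \<Rightarrow> 'a \<Rightarrow> bool" where
  "asteroidal_triple G x y z \<longleftrightarrow>
     x \<noteq> y \<and> y \<noteq> z \<and> x \<noteq> z \<and> independent_set G {x, y, z} \<and>
     path_avoiding G x y (neighbourhood G z) \<and>
     path_avoiding G y z (neighbourhood G x) \<and>
     path_avoiding G x z (neighbourhood G y)"

definition AT_free :: "('a,'b) pre_digraph \<Rightarrow> bool" where
  "AT_free G \<longleftrightarrow> \<not> (\<exists>x y z. asteroidal_triple G x y z)"

definition proper_colouring :: "('a,'b) pre_digraph \<Rightarrow> nat \<Rightarrow> ('a \<Rightarrow> nat) \<Rightarrow> bool" where
  "proper_colouring G k c \<longleftrightarrow>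
     (\<forall>v\<in>verts G. c v < k) \<and>
     (\<forall>u\<in>verts G. \<forall>v\<in>verts G. u \<rightarrow>\<^bsub>G\<^esub> v \<longrightarrow> c u \<noteq> c v)"

definition chromatic_number :: "('a,'b) pre_digraph \<Rightarrow> nat" where
  "chromatic_number G = (LEAST k. \<exists>c. proper_colouring G k c)"

text \<open>
  Points of $k$-dimensional space are extensional functions on \<^term>\<open>{..<k}\<close>, so the only
  box for \<^term>\<open>k = 0\<close> is a single point, and the graphs of boxicity 0 are the complete graphs.
\<close>

definition is_box :: "nat \<Rightarrow> (nat \<Rightarrow> real) set \<Rightarrow> bool" where
  "is_box k B \<longleftrightarrow>
     (\<exists>l r. (\<forall>i<k. l i \<le> r i) \<and> B = PiE {..<k} (\<lambda>i. {l i..r i}))"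

definition box_representation ::
    "('a,'b) pre_digraph \<Rightarrow> nat \<Rightarrow> ('a \<Rightarrow> (nat \<Rightarrow> real) set) \<Rightarrow> bool" where
  "box_representation G k f \<longleftrightarrow>
     (\<forall>v\<in>verts G. is_box k (f v)) \<and>
     (\<forall>u\<in>verts G. \<forall>v\<in>verts G. u \<noteq> v \<longrightarrow> (u \<rightarrow>\<^bsub>G\<^esub> v \<longleftrightarrow> f u \<inter> f v \<noteq> {}))"

definition boxicity :: "('a,'b) pre_digraph \<Rightarrow> nat" where
  "boxicity G = (LEAST k. \<exists>f. box_representation G k f)"

lemma (in graph) chromatic_number_attained:
  "\<exists>c. proper_colouring G (chromatic_number G) c"
proof -
  obtain c where c: "bij_betw c (verts G) {0..<card (verts G)}"
    using ex_bij_betw_finite_nat[OF finite_verts] by blast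
  have "c u \<noteq> c v" if "u \<in> verts G" "v \<in> verts G" "u \<rightarrow> v" for u v
    using that c adj_not_same unfolding bij_betw_def inj_on_def by metis
  moreover have "c v < card (verts G)" if "v \<in> verts G" for v
    using c that unfolding bij_betw_def by auto
  ultimately have "\<exists>c. proper_colouring G (card (verts G)) c"
    unfolding proper_colouring_def by blast
  then show ?thesis unfolding chromatic_number_def by (rule LeastI)
qed

lemma (in graph) boxicity_attained:
  "\<exists>f. box_representation G (boxicity G) f"
proof -
  let ?n = "card (verts G)"
  obtain e where e: "bij_betw e {0..<?n} (verts G)"
    using ex_bij_betw_nat_finite[OF finite_verts] by blast
  define l :: "'a \<Rightarrow> nat \<Rightarrow> real" where "l v i = (if v = e i \<or> e i \<rightarrow> v then 0 else 1)" for v i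
  define r :: "'a \<Rightarrow> nat \<Rightarrow> real" where "r v i = (if v = e i then 0 else 1)" for v i
  define f where "f v = PiE {..<?n} (\<lambda>i. {l v i..r v i})" for v
  have meet: "f u \<inter> f v \<noteq> {} \<longleftrightarrow> (\<forall>i<?n. {l u i..r u i} \<inter> {l v i..r v i} \<noteq> {})" for u v
    unfolding f_def by (auto simp: PiE_Int PiE_eq_empty_iff)
  have "u \<rightarrow> v \<longleftrightarrow> f u \<inter> f v \<noteq> {}"
    if u: "u \<in> verts G" and v: "v \<in> verts G" and ne: "u \<noteq> v" for u v
  proof
    assume uv: "u \<rightarrow> v"
    then have vu: "v \<rightarrow> u" using arcs_ends_symmetric[OF sym_arcs] by blast
    show "f u \<inter> f v \<noteq> {}"
      unfolding meet l_def r_def using uv vu ne by auto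
  next
    assume m: "f u \<inter> f v \<noteq> {}"
    obtain i where i: "i < ?n" "e i = u"
      using e u unfolding bij_betw_def by (metis atLeastLessThan_iff imageE)
    then have "{l u i..r u i} \<inter> {l v i..r v i} \<noteq> {}" using m meet by blast
    then show "u \<rightarrow> v"
      using i ne unfolding l_def r_def by (auto split: if_splits)
  qed
  moreover have "is_box ?n (f v)" for v
    unfolding is_box_def f_def
    by (rule exI[of _ "l v"], rule exI[of _ "r v"]) (auto simp: l_def r_def)
  ultimately have "\<exists>f. box_representation G ?n f"
    unfolding box_representation_def by blast
  then show ?thesis unfolding boxicity_def by (rule LeastI)
qed

end

theory Submission
  imports Defs
begin

text \<open>
  For each colour class \<open>S\<close> of an optimal colouring we find an interval supergraph of \<open>G\<close>
  that keeps every non-edge meeting \<open>S\<close>; the intersection of these supergraphs is \<open>G\<close>.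

  Say that \<open>y\<close> lies between \<open>x\<close> and \<open>z\<close> (all in \<open>S\<close>) if every path from \<open>x\<close> to \<open>z\<close> meets the
  neighbourhood of \<open>y\<close>. AT-freeness says that of any three vertices of \<open>S\<close> at least one lies between
  the others, and this, with two connectivity properties, suffices to order \<open>S\<close> linearly so
  that each vertex lies between its predecessors and its successors. Place \<open>S\<close> as points on
  the line in this order. The \<open>S\<close>-neighbours of a vertex outside \<open>S\<close> are then consecutive, and its
  interval runs from the gap before the first to the gap after the last of them. A component of
  vertices without neighbours in \<open>S\<close> goes into a gap common to the intervals of all its neighbours,
  which exists by Helly's theorem on the line.
\<close>

section \<open>Linear rankings from an abstract betweenness relation\<close>

locale betweenness =
  fixes S :: "'a set" and B :: "'a \<Rightarrow> 'a \<Rightarrow> 'a \<Rightarrow> bool"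
  assumes B_sym: "B x y z \<Longrightarrow> B z y x"
    and B_distinct: "B x y z \<Longrightarrow> x \<noteq> y \<and> y \<noteq> z \<and> x \<noteq> z"
    and B_split: "B x w z \<Longrightarrow> y \<in> S \<Longrightarrow> y \<noteq> w \<Longrightarrow> B x w y \<or> B y w z"
    and B_trans: "B x y z \<Longrightarrow> B x w y \<Longrightarrow> w \<noteq> z \<Longrightarrow> B x w z"
    and B_total: "x \<in> S \<Longrightarrow> y \<in> S \<Longrightarrow> z \<in> S \<Longrightarrow> x \<noteq> y \<Longrightarrow> y \<noteq> z \<Longrightarrow> x \<noteq> z \<Longrightarrow>
      B x y z \<or> B y z x \<or> B z x y"
begin

text \<open>An end \<open>y\<close> may itself lie between two others. What counts is that any two
  other elements are comparable as seen from \<open>y\<close>, ties allowed.\<close>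

definition is_end :: "'a \<Rightarrow> 'a set \<Rightarrow> bool" where
  "is_end y T \<longleftrightarrow> (\<forall>z\<in>T. \<forall>w\<in>T. z \<noteq> y \<longrightarrow> w \<noteq> y \<longrightarrow> z \<noteq> w \<longrightarrow> B y z w \<or> B y w z)"

definition strictly_nearer :: "'a \<Rightarrow> 'a \<Rightarrow> 'a \<Rightarrow> bool" where
  "strictly_nearer a z w \<longleftrightarrow> B a z w \<and> \<not> B a w z"

lemma strictly_nearer_asymp: "asymp_on T (strictly_nearer a)"
  by (auto simp: asymp_on_def strictly_nearer_def)

lemma strictly_nearer_transp: "transp_on T (strictly_nearer a)"
  unfolding transp_on_def strictly_nearer_def by (metis B_trans B_distinct)

text \<open>
  Several elements of a triple may lie between the other two, so \<open>B a\<close> only gives a preorder with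
  ties; recursion into the class of farthest elements finds one that is also an end.
\<close>

lemma ex_farthest_end:
  assumes "finite T" "T \<noteq> {}" "T \<subseteq> S" "a \<in> S" "a \<notin> T"
  shows "\<exists>y\<in>T. (\<forall>z\<in>T. B a y z \<longrightarrow> B a z y) \<and> is_end y T"
  using assms
proof (induction "card T" arbitrary: T a rule: less_induct)
  case less
  obtain y0 where y0: "y0 \<in> T" "\<And>z. z \<in> T \<Longrightarrow> z \<noteq> y0 \<Longrightarrow> \<not> strictly_nearer a y0 z"
    using Finite_Set.bex_max_element[OF less.prems(1) strictly_nearer_asymp strictly_nearer_transp less.prems(2)]
    by blast
  have max0: "B a z y0" if "z \<in> T" "B a y0 z" for z
    using y0(2)[OF that(1)] that(2) B_distinct unfolding strictly_nearer_def by blast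
  \<comment> \<open>\<open>insert y0 M\<close> is the class of elements tied with \<open>y0\<close>
    as farthest from \<open>a\<close>.\<close>
  define M where "M = {w \<in> T. B a y0 w \<and> B a w y0}"
  have M: "finite M" "M \<subseteq> S" "y0 \<notin> M" "M \<subseteq> T" "y0 \<in> S"
    using less.prems y0(1) B_distinct[of a y0 y0] unfolding M_def by auto
  obtain y where y: "y \<in> insert y0 M" "is_end y (insert y0 M)"
  proof (cases "M = {}")
    case True
    then show ?thesis using that[of y0] unfolding is_end_def by auto
  next
    case False
    have "card M < card T"
      using M y0 less.prems(1) by (metis psubset_card_mono psubsetI)
    from less.hyps[OF this M(1) False M(2) M(5) M(3)]
    obtain y where y: "y \<in> M" "\<And>z. z \<in> M \<Longrightarrow> B y0 y z \<Longrightarrow> B y0 z y" "is_end y M" by blast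
    \<comment> \<open>The recursive call is based at \<open>y0\<close>. Since \<open>y\<close> is
      farthest from \<open>y0\<close>, the bad case \<open>B y0 y w\<close> yields
      \<open>B y0 w y\<close>, so \<open>y\<close> stays an end once \<open>y0\<close> is
      added.\<close>
    have "B y y0 w \<or> B y w y0" if "w \<in> M" "w \<noteq> y" for w
      using y(1,2) that M B_total[of y y0 w] B_sym by (metis subsetD)
    then have "is_end y (insert y0 M)"
      using y(3) unfolding is_end_def by auto
    then show ?thesis using that y(1) by blast
  qed
  have yT: "y \<in> T" using y(1) M y0 by blast
  have yS: "y \<in> S" "y \<noteq> a" using yT less.prems by auto
  have ymax: "B a z y" if "z \<in> T" "B a y z" for z
    using that y(1) max0 B_trans B_distinct unfolding M_def by (metis (lifting) insertE mem_Collect_eq)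
  have tied: "z \<in> insert y0 M" if "z \<in> T" "B a y z" for z
    using that y(1) ymax[OF that] B_trans B_distinct unfolding M_def
    by (metis (mono_tags, lifting) insert_iff mem_Collect_eq)
  \<comment> \<open>As \<open>y\<close> is farthest from \<open>a\<close>, \<open>w\<close> is tied
    with it. Were \<open>z\<close> and \<open>w\<close> incomparable from \<open>y\<close>,
    splitting at \<open>w\<close> would make \<open>z\<close> tied too, but \<open>y\<close> is an
    end of the tied class.\<close>
  have one_side: "B y z w \<or> B y w z"
    if zw: "z \<in> T" "w \<in> T" "z \<noteq> y" "w \<noteq> y" "z \<noteq> w" and "B a y w" for z w
  proof (rule ccontr)
    assume neg: "\<not> (B y z w \<or> B y w z)"
    have "B a w y" using ymax \<open>B a y w\<close> zw by blast
    then have "B a w z" using B_split[of a w y z] neg zw less.prems B_sym by blast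
    then have "B a y z" using B_trans[of a w z y] \<open>B a y w\<close> zw by blast
    then have "z \<in> insert y0 M" "w \<in> insert y0 M" using tied zw \<open>B a y w\<close> by blast+
    then show False using y(2) neg zw unfolding is_end_def by blast
  qed
  have "is_end y T"
    unfolding is_end_def
  proof (intro ballI impI)
    fix z w assume zw: "z \<in> T" "w \<in> T" "z \<noteq> y" "w \<noteq> y" "z \<noteq> w"
    show "B y z w \<or> B y w z"
    proof (rule ccontr)
      assume neg: "\<not> (B y z w \<or> B y w z)"
      then have "B z y w" using B_total[of z y w] B_sym zw yS less.prems(3) by (metis subsetD)
      then have "B a y z \<or> B a y w" using B_split[of z y w a] less.prems(4) yS B_sym by metis
      then show False using one_side[of z w] one_side[of w z] zw neg by blast
    qed
  qed
  then show ?case using yT ymax by blast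
qed

text \<open>Seen from the end \<open>r\<close>, \<open>R\<close> is totally preordered, with nearest
  class \<open>M\<close>. Every member of \<open>M\<close> satisfies the first claim; to get an end
  of \<open>R\<close> as well, the proof takes one farthest from an element \<open>w0\<close> of the
  next class.\<close>

lemma ex_next_end:
  assumes R: "finite R" "R \<noteq> {}" "R \<subseteq> S" "r \<in> S" "r \<notin> R" and r: "is_end r R"
  shows "\<exists>y\<in>R. (\<forall>z\<in>R - {y}. B r y z) \<and> is_end y R"
proof -
  have tot: "B r y z \<or> B r z y" if "y \<in> R" "z \<in> R" "y \<noteq> z" for y z
    using r that R(5) unfolding is_end_def by metis
  have nearest: "\<exists>y\<in>A. \<forall>z\<in>A - {y}. B r y z" if A: "A \<subseteq> R" "A \<noteq> {}" for A
  proof -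
    have "finite A" using A R(1) finite_subset by blast
    from Finite_Set.bex_min_element[OF this strictly_nearer_asymp strictly_nearer_transp A(2)]
    show ?thesis using A tot unfolding strictly_nearer_def by (metis DiffE insertI1 subsetD)
  qed
  define M where "M = {y \<in> R. \<forall>z\<in>R - {y}. B r y z}"
  have M: "finite M" "M \<subseteq> S" "M \<noteq> {}" "M \<subseteq> R"
    using R nearest[of R] unfolding M_def by auto
  have M_upper: "\<not> B r z y" if "y \<in> M" "z \<in> R" "z \<notin> M" for y z
  proof
    assume "B r z y"
    have "B r z u" if "u \<in> R - {z}" for u
      using \<open>B r z y\<close> B_trans[of r y u z] \<open>y \<in> M\<close> that unfolding M_def by (cases "u = y") auto
    then show False using that unfolding M_def by blast
  qed
  show ?thesis
  proof (cases "M = R")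
    case True
    then show ?thesis
      using ex_farthest_end[OF R(1,2,3,4,5)] unfolding M_def by blast
  next
    case False
    then obtain w0 where w0: "w0 \<in> R - M" "\<And>z. z \<in> R - M - {w0} \<Longrightarrow> B r w0 z"
      using nearest[of "R - M"] M by blast
    obtain y where y: "y \<in> M" "\<And>z. z \<in> M \<Longrightarrow> B w0 y z \<Longrightarrow> B w0 z y" "is_end y M"
      using ex_farthest_end[OF M(1,3,2), of w0] w0(1) R(3) by blast
    have yR: "y \<in> R" "y \<in> S" "y \<noteq> r" using y(1) M R by auto
    have outer: "B y z w" if "z \<in> R" "z \<notin> M" "B r z w" for z w
      using B_split[of r z w y] M_upper[OF y(1)] that y(1) yR by blast
    \<comment> \<open>First \<open>w = w0\<close>: if \<open>w0\<close> were between
      \<open>y\<close> and \<open>z\<close>, splitting with \<open>r\<close> would put it between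
      \<open>r\<close> and a member of \<open>M\<close>; the bad case \<open>B w0 y z\<close> is
      settled by the choice of \<open>y\<close>. Any other \<open>w\<close> lies beyond
      \<open>w0\<close> from \<open>y\<close>, so \<open>B_trans\<close> applies.\<close>
    have mixed: "B y z w" if "z \<in> M" "z \<noteq> y" "w \<in> R - M" for z w
    proof -
      have zS: "z \<in> S" "z \<noteq> w0" "z \<noteq> w" "y \<noteq> w0" using that M w0 y(1) by auto
      have "\<not> B y w0 z"
      proof
        assume "B y w0 z"
        then have "B y w0 r \<or> B r w0 z" using B_split[of y w0 z r] R w0 by blast
        then show False using M_upper[of y w0] M_upper[of z w0] y(1) that w0(1) B_sym by blast
      qed
      then have base: "B y z w0"
        using B_total[of y z w0] y(2)[of z] zS yR that w0(1) R(3) B_sym by (metis DiffD1 subsetD)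
      show ?thesis
      proof (cases "w = w0")
        case False
        then have "B y w0 w" using outer[of w0 w] w0 that by blast
        then show ?thesis using B_trans[OF _ base] zS by blast
      qed (use base in simp)
    qed
    have "is_end y R"
      unfolding is_end_def
    proof (intro ballI impI)
      fix z w assume zw: "z \<in> R" "w \<in> R" "z \<noteq> y" "w \<noteq> y" "z \<noteq> w"
      show "B y z w \<or> B y w z"
        using zw y(3) mixed[of z w] mixed[of w z] outer[of z w] outer[of w z] tot[of z w]
        unfolding is_end_def by blast
    qed
    then show ?thesis using y(1) unfolding M_def by blast
  qed
qed

text \<open>Ranks fill an initial segment without holes, so that a vertex of a prescribed rank can
  be picked later.\<close>

definition between_ranking :: "'a set \<Rightarrow> ('a \<Rightarrow> nat) \<Rightarrow> bool" where
  "between_ranking T p \<longleftrightarrow> bij_betw p T {..<card T} \<and>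
     (\<forall>x\<in>T. \<forall>y\<in>T. \<forall>z\<in>T. p x < p y \<longrightarrow> p y < p z \<longrightarrow> B x y z)"

text \<open>Rank \<open>r\<close> first, then a nearest element \<open>y\<close> that is again an
  end, and recurse from \<open>y\<close>.\<close>

lemma ranking_from_end:
  assumes "finite R" "R \<subseteq> S" "r \<in> S" "r \<notin> R" "is_end r R"
  shows "\<exists>p. between_ranking (insert r R) p \<and> p r = 0"
  using assms
proof (induction "card R" arbitrary: R r rule: less_induct)
  case less
  show ?case
  proof (cases "R = {}")
    case True
    then show ?thesis
      by (intro exI[of _ "\<lambda>_. 0"]) (auto simp: between_ranking_def bij_betw_def)
  next
    case False
    obtain y where y: "y \<in> R" "\<And>z. z \<in> R - {y} \<Longrightarrow> B r y z" "is_end y R"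
      using ex_next_end[OF less.prems(1) False less.prems(2-5)] by blast
    have ins: "insert y (R - {y}) = R" using y(1) by blast
    have "card (R - {y}) < card R" using y(1) less.prems(1) by (meson card_Diff1_less)
    moreover have "is_end y (R - {y})" using y(3) unfolding is_end_def by blast
    ultimately obtain p where p: "between_ranking R p" "p y = 0"
      using less.hyps[of "R - {y}" y] less.prems(1,2) y(1) unfolding ins by blast
    define q where "q = (\<lambda>x. if x = r then 0 else Suc (p x))"
    have bij: "bij_betw p R {..<card R}" using p(1) unfolding between_ranking_def by blast
    have "q ` insert r R = insert 0 (Suc ` (p ` R))"
      using less.prems(4) unfolding q_def by (auto simp: image_iff)
    also have "\<dots> = {..<card (insert r R)}"
      using bij less.prems(1,4) by (simp add: bij_betw_def lessThan_Suc_eq_insert_0)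
    finally have "bij_betw q (insert r R) {..<card (insert r R)}"
      using bij unfolding bij_betw_def inj_on_def q_def by auto
    moreover have "B u v w"
      if "u \<in> insert r R" "v \<in> insert r R" "w \<in> insert r R" "q u < q v" "q v < q w" for u v w
    proof -
      have vw: "v \<in> R" "w \<in> R" "p v < p w"
        using that unfolding q_def by (auto split: if_splits)
      show ?thesis
      proof (cases "u = r")
        case False
        then have "u \<in> R" "p u < p v" using that unfolding q_def by (auto split: if_splits)
        then show ?thesis using p(1) vw unfolding between_ranking_def by blast
      next
        case True
        have wy: "w \<noteq> y" using vw p(2) by auto
        have "B r v w"
        proof (cases "v = y")
          case True then show ?thesis using y(2) wy vw by blast
        next
          case False
          then have "p y < p v" 
            using bij vw(1) y(1) p(2) unfolding bij_betw_def inj_on_def by (metis gr0I)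
          then have "B y v w" using p(1) y(1) vw unfolding between_ranking_def by blast
          \<comment> \<open>In the first case \<open>v\<close> is between \<open>r\<close> and
            \<open>y\<close>, and \<open>y\<close> between \<open>r\<close> and \<open>w\<close>, so
            \<open>B_trans\<close> still gives \<open>B r v w\<close>.\<close>
          then have "B y v r \<or> B r v w" using B_split less.prems(3,4) vw by blast
          moreover have "B r y w" using y(2) wy vw by blast
          ultimately show ?thesis using B_trans[of r y w v] B_sym vw(3) by blast
        qed
        then show ?thesis using True by simp
      qed
    qed
    ultimately have "between_ranking (insert r R) q"
      unfolding between_ranking_def by blast
    then show ?thesis unfolding q_def by force
  qed
qed

text \<open>A starting end \<open>r\<close> is one farthest from an arbitrary \<open>a\<close>: it
  is an end of \<open>S - {a}\<close>, and being farthest makes \<open>a\<close> comparable with the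
  rest.\<close>

theorem ex_between_ranking:
  assumes "finite S"
  shows "\<exists>p. between_ranking S p"
proof (cases "\<exists>a b. a \<in> S \<and> b \<in> S \<and> a \<noteq> b")
  case False
  then have "S = {} \<or> (\<exists>a. S = {a})" by blast
  then show ?thesis
    by (intro exI[of _ "\<lambda>_. 0"]) (auto simp: between_ranking_def bij_betw_def)
next
  case True
  then obtain a where a: "a \<in> S" "S - {a} \<noteq> {}" by blast
  then obtain r where r: "r \<in> S - {a}" "\<And>z. z \<in> S - {a} \<Longrightarrow> B a r z \<Longrightarrow> B a z r" "is_end r (S - {a})"
    using ex_farthest_end[of "S - {a}" a] assms by blast
  have "B r a w \<or> B r w a" if "w \<in> S - {a}" "w \<noteq> r" for w
    using r(1,2) that a B_total[of r a w] B_sym by (metis DiffE insertI1)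
  then have "is_end r (S - {r})" using r(3) unfolding is_end_def by (metis Diff_iff insertE insertI1 singletonD)
  moreover have "insert r (S - {r}) = S" using r(1) by blast
  ultimately show ?thesis using ranking_from_end[of "S - {r}" r] assms r(1) by auto
qed

end

section \<open>Connectivity outside neighbourhoods and the separation relation\<close>

context graph
begin

text \<open>Reflexive even outside \<open>A\<close>, so membership of an endpoint has to be supplied
  separately.\<close>

definition conn_in :: "'a set \<Rightarrow> 'a \<Rightarrow> 'a \<Rightarrow> bool" where
  "conn_in A = (\<lambda>u v. u \<rightarrow> v \<and> u \<in> A \<and> v \<in> A)\<^sup>*\<^sup>*"

lemma conn_in_refl: "conn_in A x x"
  unfolding conn_in_def by simp

lemma conn_in_trans: "conn_in A x y \<Longrightarrow> conn_in A y z \<Longrightarrow> conn_in A x z"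
  unfolding conn_in_def by simp

lemma conn_in_edge: "u \<rightarrow> v \<Longrightarrow> u \<in> A \<Longrightarrow> v \<in> A \<Longrightarrow> conn_in A u v"
  unfolding conn_in_def by blast

lemma adj_sym: "u \<rightarrow> v \<Longrightarrow> v \<rightarrow> u"
  using arcs_ends_symmetric[OF sym_arcs] by blast

lemma conn_in_sym: "conn_in A x y \<Longrightarrow> conn_in A y x"
  unfolding conn_in_def
  by (rule sympD[OF symp_rtranclp]) (auto simp: symp_def adj_sym)

lemma conn_in_mono: "conn_in A x y \<Longrightarrow> A \<subseteq> A' \<Longrightarrow> conn_in A' x y"
  unfolding conn_in_def by (rule rtranclp_mono[THEN predicate2D, rotated]) auto

lemma conn_in_path_avoiding:
  assumes "conn_in (verts G - N) x y" "y \<in> verts G - N"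
  shows "path_avoiding G x y N"
proof -
  have "\<exists>p. vwalk p G \<and> hd p = x \<and> last p = y \<and> set p \<inter> N = {}"
    using assms(1) unfolding conn_in_def
  proof (induction rule: converse_rtranclp_induct)
    case base
    then show ?case using assms(2) by (intro exI[of _ "[y]"]) auto
  next
    case (step u v)
    then obtain p where p: "vwalk p G" "hd p = v" "last p = y" "set p \<inter> N = {}" by blast
    moreover have "vwalk (u # p) G" using p step(1) by (intro vwalk_consI) auto
    moreover have "p \<noteq> []" using p(1) by blast
    ultimately show ?case using step(1) by (intro exI[of _ "u # p"]) auto
  qed
  then obtain p where p: "vwalk p G" "hd p = x" "last p = y" "set p \<inter> N = {}" by blast
  then show ?thesis
    unfolding path_avoiding_def
    by (intro exI[of _ "vwalk_to_vpath p"])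
      (auto simp: vwalk_to_vpath_hd vwalk_to_vpath_last vwalk_to_vpath_vpath dest: vwalk_to_vpath_subset)
qed

definition far :: "'a \<Rightarrow> 'a set" where
  "far y = verts G - neighbourhood G y"

lemma mem_far: "x \<in> far y \<longleftrightarrow> x \<in> verts G \<and> \<not> y \<rightarrow> x"
  unfolding far_def neighbourhood_def by blast

definition separates :: "'a set \<Rightarrow> 'a \<Rightarrow> 'a \<Rightarrow> 'a \<Rightarrow> bool" where
  "separates S x y z \<longleftrightarrow> x \<in> S \<and> y \<in> S \<and> z \<in> S \<and> x \<noteq> y \<and> y \<noteq> z \<and> x \<noteq> z \<and>
     \<not> conn_in (far y) x z"

text \<open>If no vertex of \<open>A\<close> reachable from \<open>x\<close> inside \<open>A\<close>
  were a neighbour of \<open>y\<close>, the whole walk would stay in \<open>far y\<close>.\<close>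

lemma conn_in_meets_nbhd:
  assumes "conn_in A x z" "x \<in> A" "A \<subseteq> verts G" "\<not> conn_in (far y) x z"
  shows "\<exists>u\<in>A. conn_in A x u \<and> y \<rightarrow> u"
proof (rule ccontr)
  assume none: "\<not> ?thesis"
  have "conn_in (far y) x z \<and> conn_in A x z \<and> z \<in> A"
    using assms(1) unfolding conn_in_def[of A]
  proof (induction rule: rtranclp_induct)
    case base
    then show ?case using assms(2) by (simp add: conn_in_refl)
  next
    case (step u v)
    then have u: "conn_in (far y) x u" "conn_in A x u" unfolding conn_in_def[of A] by auto
    then have v: "conn_in A x v" using step(2) conn_in_edge conn_in_trans by blast
    have "u \<in> far y" "v \<in> far y" using none u v step(2) assms(3) mem_far by blast+
    then show ?case
      using conn_in_trans[OF u(1) conn_in_edge] v step(2) unfolding conn_in_def[of A] by blast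
  qed
  then show False using assms(4) by blast
qed

text \<open>Splitting: no \<open>y\<close> is connected to both sides of a separated pair.
  Transitivity: a walk from \<open>x\<close> to \<open>z\<close> avoiding the neighbours of
  \<open>w\<close> meets a neighbour of \<open>y\<close>, from where it can turn to
  \<open>y\<close>. Totality is AT-freeness.\<close>

lemma separates_betweenness:
  assumes AT: "AT_free G" and S: "independent_set G S"
  shows "betweenness S (separates S)"
proof
  have SV: "S \<subseteq> verts G" and ind: "\<And>u v. u \<in> S \<Longrightarrow> v \<in> S \<Longrightarrow> \<not> u \<rightarrow> v"
    using S unfolding independent_set_def by auto
  have S_far: "x \<in> far y" if "x \<in> S" "y \<in> S" for x y
    using that SV ind mem_far by blast
  show "separates S z y x" if "separates S x y z" for x y z
    using that conn_in_sym unfolding separates_def by blast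
  show "x \<noteq> y \<and> y \<noteq> z \<and> x \<noteq> z" if "separates S x y z" for x y z
    using that unfolding separates_def by blast
  show "separates S x w y \<or> separates S y w z"
    if "separates S x w z" "y \<in> S" "y \<noteq> w" for x w z y
    using that conn_in_trans conn_in_refl unfolding separates_def by metis
  show "separates S x w z"
    if sep: "separates S x y z" "separates S x w y" "w \<noteq> z" for x y z w
  proof (rule ccontr)
    assume "\<not> separates S x w z"
    then have "conn_in (far w) x z" using sep unfolding separates_def by blast
    then obtain u where u: "u \<in> far w" "conn_in (far w) x u" "y \<rightarrow> u"
      using conn_in_meets_nbhd[of "far w" x z y] sep S_far[of x w] unfolding separates_def far_def
      by blast
    moreover have "y \<in> far w" using sep S_far unfolding separates_def by blast
    ultimately have "conn_in (far w) x y"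
      using conn_in_trans[OF u(2) conn_in_edge[OF adj_sym[OF u(3)]]] by blast
    then show False using sep(2) unfolding separates_def by blast
  qed
  show "separates S x y z \<or> separates S y z x \<or> separates S z x y"
    if xyz: "x \<in> S" "y \<in> S" "z \<in> S" "x \<noteq> y" "y \<noteq> z" "x \<noteq> z" for x y z
  proof (rule ccontr)
    assume "\<not> ?thesis"
    then have "conn_in (far y) x z" "conn_in (far z) y x" "conn_in (far x) z y"
      using xyz unfolding separates_def by auto
    moreover have path: "path_avoiding G u v (neighbourhood G w)"
      if "conn_in (far w) u v" "v \<in> S" "w \<in> S" for u v w
      using conn_in_path_avoiding S_far[of v w] that unfolding far_def by blast
    ultimately have "path_avoiding G x z (neighbourhood G y)" "path_avoiding G x y (neighbourhood G z)"
      "path_avoiding G y z (neighbourhood G x)"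
      using path conn_in_sym xyz by metis+
    moreover have "independent_set G {x, y, z}"
      using xyz SV ind unfolding independent_set_def by blast
    ultimately show False using AT xyz unfolding AT_free_def asteroidal_triple_def by blast
  qed
qed

section \<open>An interval supergraph for one independent set\<close>

lemma ex_interval_supergraph:
  assumes AT: "AT_free G" and S: "independent_set G S"
  shows "\<exists>l r :: 'a \<Rightarrow> nat. (\<forall>v\<in>verts G. l v \<le> r v) \<and> (\<forall>u v. u \<rightarrow> v \<longrightarrow> l u \<le> r v) \<and>
    (\<forall>u\<in>S. \<forall>v\<in>verts G. u \<noteq> v \<longrightarrow> \<not> u \<rightarrow> v \<longrightarrow> r u < l v \<or> r v < l u)"
proof -
  have SV: "S \<subseteq> verts G" and ind: "\<And>u v. u \<in> S \<Longrightarrow> v \<in> S \<Longrightarrow> \<not> u \<rightarrow> v"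
    using S unfolding independent_set_def by auto
  have finS: "finite S" using SV finite_verts finite_subset by blast
  interpret betweenness S "separates S" using separates_betweenness[OF AT S] .
  obtain p where "between_ranking S p" using ex_between_ranking[OF finS] by blast
  then have bij: "bij_betw p S {..<card S}"
    and mid: "\<And>x y z. x \<in> S \<Longrightarrow> y \<in> S \<Longrightarrow> z \<in> S \<Longrightarrow> p x < p y \<Longrightarrow> p y < p z \<Longrightarrow> \<not> conn_in (far y) x z"
    unfolding between_ranking_def separates_def by blast+
  have inj: "x = y" if "x \<in> S" "y \<in> S" "p x = p y" for x y
    using bij that unfolding bij_betw_def inj_on_def by blast

  define nb where "nb x = {s \<in> S. x \<rightarrow> s}" for x
  define lo where "lo x = Min (p ` nb x)" for x
  define hi where "hi x = Max (p ` nb x)" for x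
  define U where "U = {x \<in> verts G. x \<notin> S \<and> nb x \<noteq> {}}"
  define W where "W = {x \<in> verts G. x \<notin> S \<and> nb x = {}}"
  have fin_nb: "finite (nb x)" for x using finS unfolding nb_def by simp
  have lo_le: "lo x \<le> p s" and le_hi: "p s \<le> hi x" if "s \<in> nb x" for x s
    using that fin_nb unfolding lo_def hi_def by auto
  have "lo x \<in> p ` nb x" "hi x \<in> p ` nb x" if "x \<in> U" for x
    using that fin_nb[of x] unfolding lo_def hi_def U_def by (auto intro!: Min_in Max_in)
  then have ex_lo: "\<exists>s\<in>nb x. p s = lo x" and ex_hi: "\<exists>s\<in>nb x. p s = hi x" if "x \<in> U" for x
    using that by (metis imageE)+
  have lo_hi: "lo x \<le> hi x" if "x \<in> U" for x
    using ex_lo[OF that] le_hi by metis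

  \<comment> \<open>Otherwise \<open>a\<close>, \<open>x\<close>, \<open>b\<close> would be a walk
    past \<open>s\<close> that avoids its neighbourhood.\<close>
  have consecutive: "x \<rightarrow> s" if x: "x \<in> U" and s: "s \<in> S" "lo x \<le> p s" "p s \<le> hi x" for x s
  proof (rule ccontr)
    assume neg: "\<not> x \<rightarrow> s"
    obtain a b where ab: "a \<in> nb x" "p a = lo x" "b \<in> nb x" "p b = hi x"
      using ex_lo ex_hi x by metis
    have ab': "a \<in> S" "b \<in> S" "x \<rightarrow> a" "x \<rightarrow> b" using ab unfolding nb_def by auto
    have "p a < p s" "p s < p b" using ab ab' s inj neg by (metis le_neq_implies_less)+
    then have "\<not> conn_in (far s) a b" using mid ab' s by blast
    moreover have "a \<in> far s" "b \<in> far s" "x \<in> far s"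
      using ab' s SV ind neg adj_sym[of s x] x unfolding mem_far U_def by blast+
    ultimately show False
      using conn_in_trans[OF conn_in_edge[OF adj_sym[OF ab'(3)]] conn_in_edge[OF ab'(4)]] by blast
  qed

  \<comment> \<open>If this fails, the vertex \<open>s\<close> of rank \<open>hi y + 1\<close> has
    no neighbour among \<open>y\<close>, \<open>y'\<close> and \<open>W\<close>, so \<open>a\<close>
    reaches \<open>b\<close> through them although \<open>s\<close> is ranked between. The
    \<open>+ 1\<close> lets two intervals share just a gap.\<close>
  have linked: "lo y' \<le> hi y + 1"
    if y: "y \<in> U" "y' \<in> U" and c: "conn_in (W \<union> {y, y'}) y y'" for y y'
  proof (rule ccontr)
    assume gap: "\<not> lo y' \<le> hi y + 1"
    obtain a b where ab: "a \<in> nb y" "p a = hi y" "b \<in> nb y'" "p b = lo y'"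
      using ex_lo ex_hi y by metis
    have ab': "a \<in> S" "b \<in> S" "y \<rightarrow> a" "y' \<rightarrow> b" using ab unfolding nb_def by auto
    have "p b < card S" using ab' bij unfolding bij_betw_def by blast
    then have "hi y + 1 \<in> p ` S" using bij gap ab unfolding bij_betw_def by auto
    then obtain s where s: "s \<in> S" "p s = hi y + 1" by auto
    have "s \<notin> nb y" "s \<notin> nb y'" using le_hi[of s y] lo_le[of s y'] s gap by auto
    then have "y \<in> far s" "y' \<in> far s"
      using y s adj_sym[of s y] adj_sym[of s y'] unfolding mem_far U_def nb_def by blast+
    moreover have "W \<subseteq> far s"
      using s adj_sym[of s] unfolding W_def nb_def mem_far subset_iff by blast
    ultimately have "conn_in (far s) y y'" using conn_in_mono[OF c] by blast
    moreover have "a \<in> far s" "b \<in> far s" using ab' s SV ind unfolding mem_far by blast+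
    ultimately have "conn_in (far s) a b"
      using \<open>y \<in> far s\<close> \<open>y' \<in> far s\<close> conn_in_edge[OF ab'(4)]
        conn_in_edge[OF adj_sym[OF ab'(3)]] conn_in_trans by metis
    moreover have "p a < p s" "p s < p b" using ab s gap by auto
    ultimately show False using mid ab' s by blast
  qed

  \<comment> \<open>Only the source of a step must lie in \<open>W\<close>: a walk may end in
    \<open>U\<close> but not pass through it. For \<open>x\<close> in \<open>W\<close>,
    \<open>D x\<close> thus collects the neighbours in \<open>U\<close> of its component.\<close>
  define reach where "reach = (\<lambda>u v. u \<rightarrow> v \<and> u \<in> W)\<^sup>*\<^sup>*"
  define D where "D x = {y \<in> U. reach x y}" for x
  \<comment> \<open>The Helly point: the largest left end, counted in gaps. The default 0 serves
    components without neighbours in \<open>U\<close>, for which any gap will do.\<close>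
  define g where "g x = (if D x = {} then 0 else Max (lo ` D x))" for x
  have finD: "finite (D x)" for x unfolding D_def U_def by simp
  have reach_conn: "conn_in (insert y W) x y" if "reach x y" for x y
    using that unfolding reach_def
  proof (induction rule: rtranclp_induct)
    case base
    then show ?case by (rule conn_in_refl)
  next
    case (step u v)
    then have "conn_in (insert v W) x u"
      using conn_in_mono[of "insert u W" x u "insert v W"] by blast
    then show ?case using step(2) conn_in_edge[of u v "insert v W"] conn_in_trans by blast
  qed
  have linkedD: "lo y' \<le> hi y + 1" if "y \<in> D x" "y' \<in> D x" for x y y'
  proof (rule linked)
    have "conn_in (W \<union> {y, y'}) x y" "conn_in (W \<union> {y, y'}) x y'"
      using that conn_in_mono[OF reach_conn[of x y], of "W \<union> {y, y'}"]
        conn_in_mono[OF reach_conn[of x y'], of "W \<union> {y, y'}"] unfolding D_def by auto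
    then show "conn_in (W \<union> {y, y'}) y y'" using conn_in_sym conn_in_trans by blast
  qed (use that in \<open>auto simp: D_def\<close>)

  \<comment> \<open>The vertices of \<open>S\<close> sit at odd integers, and the gaps between them at even ones.\<close>
  define l where "l x = (if x \<in> S then 2 * p x + 1 else if x \<in> U then 2 * lo x else 2 * g x)" for x
  define r where "r x = (if x \<in> S then 2 * p x + 1 else if x \<in> U then 2 * hi x + 2 else 2 * g x)" for x
  have lS: "l x = 2 * p x + 1" "r x = 2 * p x + 1" if "x \<in> S" for x
    using that unfolding l_def r_def by auto
  have lU: "l x = 2 * lo x" "r x = 2 * hi x + 2" if "x \<in> U" for x
    using that unfolding l_def r_def U_def by auto
  have lW: "l x = 2 * g x" "r x = 2 * g x" if "x \<in> W" for x
    using that unfolding l_def r_def U_def W_def by auto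
  have cases3: "x \<in> S \<or> x \<in> U \<or> x \<in> W" if "x \<in> verts G" for x
    using that unfolding U_def W_def by blast

  have "l v \<le> r v" if "v \<in> verts G" for v
    using cases3[OF that] lS[of v] lU[of v] lW[of v] lo_hi[of v] by auto
  moreover have "l u \<le> r v" if uv: "u \<rightarrow> v" for u v
  proof -
    have V: "u \<in> verts G" "v \<in> verts G" using uv by auto
    have vu: "v \<rightarrow> u" using adj_sym uv .
    have one: "reach u v" if "u \<in> W" using that uv unfolding reach_def by blast
    have one': "reach v u" if "v \<in> W" using that vu unfolding reach_def by blast
    consider "u \<in> S" "v \<in> S" | "u \<in> S" "v \<in> U" | "u \<in> S" "v \<in> W" | "u \<in> U" "v \<in> S"
      | "u \<in> U" "v \<in> U" | "u \<in> U" "v \<in> W" | "u \<in> W" "v \<in> S" | "u \<in> W" "v \<in> U" | "u \<in> W" "v \<in> W"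
      using cases3 V by blast
    then show ?thesis
    proof cases
      case 1 then show ?thesis using ind uv by blast
    next
      case 2
      then have "p u \<le> hi v" using vu le_hi unfolding nb_def by blast
      then show ?thesis using 2 lS lU by simp
    next
      case 3 then show ?thesis using vu unfolding W_def nb_def by blast
    next
      case 4
      then have "lo u \<le> p v" using uv lo_le unfolding nb_def by blast
      then show ?thesis using 4 lS lU by simp
    next
      case 5
      then have "lo u \<le> hi v + 1" using linked[of v u] conn_in_edge[OF vu, of "W \<union> {v, u}"] by simp
      then show ?thesis using 5 lU by simp
    next
      case 6
      then have "u \<in> D v" using one' unfolding D_def by blast
      then have "lo u \<le> g v" using finD unfolding g_def by auto
      then show ?thesis using 6 lU lW by simp
    next
      case 7 then show ?thesis using uv unfolding W_def nb_def by blast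
    next
      case 8
      then have v: "v \<in> D u" using one unfolding D_def by blast
      \<comment> \<open>The maximum is \<open>lo y'\<close> for some \<open>y'\<close> in
        \<open>D u\<close>, and \<open>linkedD\<close> compares it with every right end.\<close>
      then have "g u \<in> lo ` D u" using Max_in[of "lo ` D u"] finD unfolding g_def by auto
      then have "g u \<le> hi v + 1" using linkedD[OF v] by auto
      then show ?thesis using 8 lU lW by simp
    next
      case 9
      then have "reach u v" "reach v u" using one one' by auto
      then have "reach u y \<longleftrightarrow> reach v y" for y unfolding reach_def by (meson rtranclp_trans)
      then have "D u = D v" unfolding D_def by simp
      then show ?thesis using 9 lW unfolding g_def by simp
    qed
  qed
  moreover have "r u < l v \<or> r v < l u"
    if u: "u \<in> S" and v: "v \<in> verts G" "u \<noteq> v" "\<not> u \<rightarrow> v" for u v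
  proof -
    consider "v \<in> S" | "v \<in> U" | "v \<in> W" using cases3 v by blast
    then show ?thesis
    proof cases
      case 1
      then have "p u \<noteq> p v" using inj u v by blast
      then show ?thesis using lS 1 u by auto
    next
      case 2
      then have "\<not> (lo v \<le> p u \<and> p u \<le> hi v)" using consecutive[of v u] u v adj_sym[of v u] by blast
      then show ?thesis using lS u lU 2 by auto
    next
      case 3
      have "2 * p u + 1 \<noteq> 2 * g v" by presburger
      then show ?thesis using lS u lW 3 by auto
    qed
  qed
  ultimately show ?thesis by blast
qed

section \<open>One coordinate per colour class\<close>

lemma box_representation_of_colouring:
  assumes AT: "AT_free G" and c: "proper_colouring G k c"
  shows "\<exists>f. box_representation G k f"
proof -
  define S where "S i = {v \<in> verts G. c v = i}" for i
  have "independent_set G (S i)" for i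
    using c unfolding independent_set_def proper_colouring_def S_def by blast
  then have "\<forall>i. \<exists>l r :: 'a \<Rightarrow> nat. (\<forall>v\<in>verts G. l v \<le> r v) \<and> (\<forall>u v. u \<rightarrow> v \<longrightarrow> l u \<le> r v) \<and>
    (\<forall>u\<in>S i. \<forall>v\<in>verts G. u \<noteq> v \<longrightarrow> \<not> u \<rightarrow> v \<longrightarrow> r u < l v \<or> r v < l u)"
    using ex_interval_supergraph[OF AT] by blast
  then obtain l r :: "nat \<Rightarrow> 'a \<Rightarrow> nat" where
    lr: "\<And>i v. v \<in> verts G \<Longrightarrow> l i v \<le> r i v" and
    edge: "\<And>i u v. u \<rightarrow> v \<Longrightarrow> l i u \<le> r i v" and
    nonedge: "\<And>i u v. u \<in> S i \<Longrightarrow> v \<in> verts G \<Longrightarrow> u \<noteq> v \<Longrightarrow> \<not> u \<rightarrow> v \<Longrightarrow>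
      r i u < l i v \<or> r i v < l i u"
    by metis
  define f where "f v = PiE {..<k} (\<lambda>i. {real (l i v)..real (r i v)})" for v
  have meet: "f u \<inter> f v \<noteq> {} \<longleftrightarrow> (\<forall>i<k. l i u \<le> r i v \<and> l i v \<le> r i u)"
    if "u \<in> verts G" "v \<in> verts G" for u v
    using lr[OF that(1)] lr[OF that(2)] unfolding f_def by (auto simp: PiE_Int PiE_eq_empty_iff)
  have "u \<rightarrow> v \<longleftrightarrow> f u \<inter> f v \<noteq> {}" if uv: "u \<in> verts G" "v \<in> verts G" "u \<noteq> v" for u v
  proof
    assume "u \<rightarrow> v"
    then show "f u \<inter> f v \<noteq> {}" using edge[of u v] edge[OF adj_sym[of u v]] meet uv by blast
  next
    assume m: "f u \<inter> f v \<noteq> {}"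
    \<comment> \<open>A non-edge at \<open>u\<close> is already excluded in coordinate
      \<open>c u\<close>, whose supergraph keeps all non-edges meeting the class of
      \<open>u\<close>.\<close>
    have "c u < k" "u \<in> S (c u)" using c uv unfolding proper_colouring_def S_def by auto
    then show "u \<rightarrow> v" using m meet uv nonedge[of u "c u" v] by (meson leD)
  qed
  moreover have "is_box k (f v)" if "v \<in> verts G" for v
    unfolding is_box_def f_def
    by (rule exI[of _ "\<lambda>i. real (l i v)"], rule exI[of _ "\<lambda>i. real (r i v)"]) (simp add: lr that)
  ultimately show ?thesis unfolding box_representation_def by blast
qed

end

theorem theorem4:
  fixes G :: "('a,'b) pre_digraph"
  assumes "graph G"
    and "AT_free G"
  shows "boxicity G \<le> chromatic_number G"
proof -
  interpret graph G by fact
  obtain c where "proper_colouring G (chromatic_number G) c"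
    using chromatic_number_attained by blast
  then show ?thesis
    unfolding boxicity_def using box_representation_of_colouring[OF assms(2)] by (blast intro: Least_le)
qed

end
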